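(* Let $M\in\mathbb{R}^{n\times m}$ with grammar representation $(\mathcal{C},\mathcal{R},V)$, $\mathcal{C}=N_{i_1}\$_1\cdots N_{i_n}\$_n$, containing no useless rules. Given $(\mathcal{C},\mathcal{R},V)$ and a vector $y\in\mathbb{R}^n$, the product $x^t=y^tM$ can be computed in $\mathcal{O}(|\mathcal{C}|+|\mathcal{R}|)$ time using $\mathcal{O}(|\mathcal{R}|)$ words of auxiliary space.
   Context: CSRV representation: for $M\in\mathbb{R}^{n\times m}$, let $V[1,k]$ be an array containing the distinct non-zero values of $M$. The sequence $S$ is obtained by scanning $M$ row by row: for each entry $M[i][j]\neq 0$ one appends the pair $\langle \ell,j\rangle$ where $V[\ell]=M[i][j]$, and at the end of row $i$ one appends a special symbol $\$_i$. Grammar representation: a straight-line program with rules $N_i\to AB$ ($i=1,\dots,q$), one per nonterminal, where each of $A,B$ is a terminal pair or a nonterminal $N_j$ with $j<i$; no rule contains a symbol $\$_r$; $\mathrm{exp}(N_i)$ is the string of pairs obtained by repeatedly substituting rules. $\mathcal{R}$ is the set of rules ($|\mathcal{R}|=q$) and $\mathcal{C}=N_{i_1}\$_1\cdots N_{i_n}\$_n$ where $\mathrm{exp}(N_{i_r})$ is exactly the sequence of pairs in $S$ representing the non-zero entries of row $r$. No useless rules: every nonterminal appears in the right-hand side of some rule or in $\mathcal{C}$. Complexity is measured in a word-RAM model where arithmetic on reals and indices takes unit time. *)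

theory Defs
  imports
    "Jordan_Normal_Form.Matrix"
    "HOL-Library.Monad_Syntax"
begin

section \<open>Grammar representation of a matrix\<close>

text \<open>All indices (rows, columns, entries of \<open>V\<close>, nonterminals) are 0-based. \<open>Nt i\<close> is the
  nonterminal \<open>N\<^sub>i\<close>, whose unique rule is the \<open>i\<close>-th entry of the list of rules, and \<open>EndRow r\<close> is the
  special symbol that closes row \<open>r\<close>.\<close>

datatype symbol = Pair nat nat | Nt nat | EndRow nat

type_synonym rules = "(symbol \<times> symbol) list"

definition csrv_row :: "real mat \<Rightarrow> real list \<Rightarrow> nat \<Rightarrow> (nat \<times> nat) list" where
  "csrv_row M V r =
     map (\<lambda>j. (THE l. l < length V \<and> V ! l = M $$ (r, j), j))
       (filter (\<lambda>j. M $$ (r, j) \<noteq> 0) [0..<dim_col M])"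

fun rule_symbol_ok :: "nat \<Rightarrow> symbol \<Rightarrow> bool" where
  "rule_symbol_ok i (Pair l j) = True"
| "rule_symbol_ok i (Nt j) = (j < i)"
| "rule_symbol_ok i (EndRow r) = False"

definition straight_line :: "rules \<Rightarrow> bool" where
  "straight_line R \<longleftrightarrow>
     (\<forall>i < length R. rule_symbol_ok i (fst (R ! i)) \<and> rule_symbol_ok i (snd (R ! i)))"

text \<open>\<open>expands_to R (Nt i) u\<close> says that \<open>exp(N\<^sub>i) = u\<close>. For a straight-line \<open>R\<close> and \<open>i < length R\<close>
  there is exactly one such \<open>u\<close>.\<close>

inductive expands_to :: "rules \<Rightarrow> symbol \<Rightarrow> (nat \<times> nat) list \<Rightarrow> bool" for R where
  "expands_to R (Pair l j) [(l, j)]"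
| "i < length R \<Longrightarrow> R ! i = (A, B) \<Longrightarrow> expands_to R A u \<Longrightarrow> expands_to R B v
     \<Longrightarrow> expands_to R (Nt i) (u @ v)"

definition grammar_representation ::
  "real mat \<Rightarrow> symbol list \<Rightarrow> rules \<Rightarrow> real list \<Rightarrow> bool" where
  "grammar_representation M C R V \<longleftrightarrow>
     distinct V \<and> set V = elements_mat M - {0} \<and>
     straight_line R \<and>
     (\<exists>\<iota>. C = concat (map (\<lambda>r. [Nt (\<iota> r), EndRow r]) [0..<dim_row M]) \<and>
          (\<forall>r < dim_row M. \<iota> r < length R \<and> expands_to R (Nt (\<iota> r)) (csrv_row M V r)))"

definition no_useless_rules :: "symbol list \<Rightarrow> rules \<Rightarrow> bool" where
  "no_useless_rules C R \<longleftrightarrow>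
     (\<forall>i < length R. Nt i \<in> set C \<or> (\<exists>(A, B) \<in> set R. A = Nt i \<or> B = Nt i))"

definition vec_mult_mat :: "real vec \<Rightarrow> real mat \<Rightarrow> real vec" where
  "vec_mult_mat y M = vec (dim_col M) (\<lambda>j. y \<bullet> col M j)"


section \<open>A word RAM with real arithmetic\<close>

text \<open>A word holds either an index (a natural number below \<open>2^w\<close>, where \<open>w\<close> is the word length) or a
  real number. There are three memories: a read-only input, a working memory, and an output array
  that can be read and written. Operand addresses in instructions are absolute addresses of the
  working memory, so the low cells of the working memory play the role of registers and the
  length of the working memory is the total auxiliary space, registers included. \<open>Load\<close>, \<open>Store\<close>,
  \<open>ReadIn\<close>, \<open>ReadOut\<close> and \<open>WriteOut\<close> address indirectly. Every instruction takes unit time. An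
  out-of-range address, an index overflow or an operand of the wrong kind makes the machine fail.
  There is no conversion between reals and indices. Index subtraction is truncated and index
  division rounds down.\<close>

datatype ram_word = Idx nat | Num real

datatype arith = Plus | Minus | Times | Divide

datatype instr =
    SetIdx nat nat
  | SetNum nat int
  | Move nat nat
  | Arith arith nat nat nat
  | Load nat nat
  | Store nat nat
  | ReadIn nat nat
  | ReadOut nat nat
  | WriteOut nat nat
  | Jump nat
  | JumpLess nat nat nat
  | JumpEq nat nat nat
  | Halt

type_synonym program = "instr list"

text \<open>Program counter, working memory, output array.\<close>

type_synonym config = "nat \<times> ram_word list \<times> ram_word list"

definition fetch :: "ram_word list \<Rightarrow> nat \<Rightarrow> ram_word option" where
  "fetch xs a = (if a < length xs then Some (xs ! a) else None)"

definition put :: "ram_word list \<Rightarrow> nat \<Rightarrow> ram_word \<Rightarrow> ram_word list option" where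
  "put xs a v = (if a < length xs then Some (xs[a := v]) else None)"

definition fetch_idx :: "ram_word list \<Rightarrow> nat \<Rightarrow> nat option" where
  "fetch_idx xs a = do { v \<leftarrow> fetch xs a; case v of Idx i \<Rightarrow> Some i | Num x \<Rightarrow> None }"

definition make_idx :: "nat \<Rightarrow> nat \<Rightarrow> ram_word option" where
  "make_idx w i = (if i < 2 ^ w then Some (Idx i) else None)"

fun idx_arith :: "arith \<Rightarrow> nat \<Rightarrow> nat \<Rightarrow> nat" where
  "idx_arith Plus a b = a + b"
| "idx_arith Minus a b = a - b"
| "idx_arith Times a b = a * b"
| "idx_arith Divide a b = a div b"

fun num_arith :: "arith \<Rightarrow> real \<Rightarrow> real \<Rightarrow> real" where
  "num_arith Plus a b = a + b"
| "num_arith Minus a b = a - b"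
| "num_arith Times a b = a * b"
| "num_arith Divide a b = a / b"

fun word_arith :: "nat \<Rightarrow> arith \<Rightarrow> ram_word \<Rightarrow> ram_word \<Rightarrow> ram_word option" where
  "word_arith w f (Idx a) (Idx b) = make_idx w (idx_arith f a b)"
| "word_arith w f (Num a) (Num b) = Some (Num (num_arith f a b))"
| "word_arith w f _ _ = None"

fun word_less :: "ram_word \<Rightarrow> ram_word \<Rightarrow> bool option" where
  "word_less (Idx a) (Idx b) = Some (a < b)"
| "word_less (Num a) (Num b) = Some (a < b)"
| "word_less _ _ = None"

fun word_eq :: "ram_word \<Rightarrow> ram_word \<Rightarrow> bool option" where
  "word_eq (Idx a) (Idx b) = Some (a = b)"
| "word_eq (Num a) (Num b) = Some (a = b)"
| "word_eq _ _ = None"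

fun exec :: "nat \<Rightarrow> ram_word list \<Rightarrow> instr \<Rightarrow> config \<Rightarrow> config option" where
  "exec w inp (SetIdx d i) (pc, mem, out) =
     do { v \<leftarrow> make_idx w i; mem' \<leftarrow> put mem d v; Some (Suc pc, mem', out) }"
| "exec w inp (SetNum d i) (pc, mem, out) =
     do { mem' \<leftarrow> put mem d (Num (of_int i)); Some (Suc pc, mem', out) }"
| "exec w inp (Move d a) (pc, mem, out) =
     do { v \<leftarrow> fetch mem a; mem' \<leftarrow> put mem d v; Some (Suc pc, mem', out) }"
| "exec w inp (Arith f d a b) (pc, mem, out) =
     do { u \<leftarrow> fetch mem a; v \<leftarrow> fetch mem b; x \<leftarrow> word_arith w f u v;
          mem' \<leftarrow> put mem d x; Some (Suc pc, mem', out) }"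
| "exec w inp (Load d a) (pc, mem, out) =
     do { i \<leftarrow> fetch_idx mem a; v \<leftarrow> fetch mem i; mem' \<leftarrow> put mem d v; Some (Suc pc, mem', out) }"
| "exec w inp (Store a b) (pc, mem, out) =
     do { i \<leftarrow> fetch_idx mem a; v \<leftarrow> fetch mem b; mem' \<leftarrow> put mem i v; Some (Suc pc, mem', out) }"
| "exec w inp (ReadIn d a) (pc, mem, out) =
     do { i \<leftarrow> fetch_idx mem a; v \<leftarrow> fetch inp i; mem' \<leftarrow> put mem d v; Some (Suc pc, mem', out) }"
| "exec w inp (ReadOut d a) (pc, mem, out) =
     do { i \<leftarrow> fetch_idx mem a; v \<leftarrow> fetch out i; mem' \<leftarrow> put mem d v; Some (Suc pc, mem', out) }"
| "exec w inp (WriteOut a b) (pc, mem, out) =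
     do { i \<leftarrow> fetch_idx mem a; v \<leftarrow> fetch mem b; out' \<leftarrow> put out i v; Some (Suc pc, mem, out') }"
| "exec w inp (Jump l) (pc, mem, out) = Some (l, mem, out)"
| "exec w inp (JumpLess a b l) (pc, mem, out) =
     do { u \<leftarrow> fetch mem a; v \<leftarrow> fetch mem b; t \<leftarrow> word_less u v;
          Some (if t then l else Suc pc, mem, out) }"
| "exec w inp (JumpEq a b l) (pc, mem, out) =
     do { u \<leftarrow> fetch mem a; v \<leftarrow> fetch mem b; t \<leftarrow> word_eq u v;
          Some (if t then l else Suc pc, mem, out) }"
| "exec w inp Halt (pc, mem, out) = None"

definition step :: "nat \<Rightarrow> program \<Rightarrow> ram_word list \<Rightarrow> config \<Rightarrow> config option" where
  "step w P inp cfg = (if fst cfg < length P then exec w inp (P ! fst cfg) cfg else None)"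

fun run :: "nat \<Rightarrow> program \<Rightarrow> ram_word list \<Rightarrow> nat \<Rightarrow> config \<Rightarrow> config option" where
  "run w P inp 0 cfg = Some cfg"
| "run w P inp (Suc t) cfg = do { cfg' \<leftarrow> step w P inp cfg; run w P inp t cfg' }"

definition halted :: "program \<Rightarrow> config \<Rightarrow> bool" where
  "halted P cfg \<longleftrightarrow> fst cfg < length P \<and> P ! fst cfg = Halt"

text \<open>\<open>mem\<close> is the initial content of the working memory (whose length never changes) and \<open>out\<close> that
  of the output array; the run must halt properly after at most \<open>T\<close> steps.\<close>

definition computes_within ::
  "nat \<Rightarrow> program \<Rightarrow> ram_word list \<Rightarrow> ram_word list \<Rightarrow> ram_word list \<Rightarrow> nat \<Rightarrow> ram_word list \<Rightarrow> bool"
  where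
  "computes_within w P inp mem out T res \<longleftrightarrow>
     (\<exists>t pc mem'. t \<le> T \<and> run w P inp t (0, mem, out) = Some (pc, mem', res)
        \<and> halted P (pc, mem', res))"


section \<open>Input layout\<close>

text \<open>Each symbol occupies three words, the first of which tells the kind of the symbol.\<close>

fun encode_symbol :: "symbol \<Rightarrow> ram_word list" where
  "encode_symbol (Pair l j) = [Idx 0, Idx l, Idx j]"
| "encode_symbol (Nt i) = [Idx 1, Idx i, Idx 0]"
| "encode_symbol (EndRow r) = [Idx 2, Idx r, Idx 0]"

definition encode_input ::
  "nat \<Rightarrow> nat \<Rightarrow> symbol list \<Rightarrow> rules \<Rightarrow> real list \<Rightarrow> real vec \<Rightarrow> ram_word list" where
  "encode_input n m C R V y =
     [Idx n, Idx m, Idx (length R), Idx (length V)]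
     @ concat (map encode_symbol C)
     @ concat (map (\<lambda>(A, B). encode_symbol A @ encode_symbol B) R)
     @ map Num V
     @ map Num (list_of_vec y)"

text \<open>Conventions for resource bounds: one program serves all instances. The word length \<open>w\<close> is only
  required to be large enough that \<open>2^w\<close> exceeds the length of input plus output by some constant
  factor. The working memory contains arbitrary data at the start, so initializing it is part of
  the running time. The output array starts out as zero: \<open>M\<close> may have arbitrarily many zero columns,
  so no bound in terms of \<open>C\<close> and \<open>R\<close> alone could pay for clearing it. Input and output are not
  auxiliary space.\<close>

end

theory Submission
  imports Defs
begin

text \<open>Let \<open>f i j\<close> be the sum of the values in column \<open>j\<close> over the pairs of \<open>exp(N\<^sub>i)\<close>. With
  one weight \<open>W i\<close> per nonterminal, initially the sum of \<open>y r\<close> over the rows \<open>r\<close> generated by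
  \<open>N\<^sub>i\<close>, the product is \<open>x j = (\<Sum>i. W i * f i j)\<close>. The symbols on the right-hand sides of the rules
  are processed from the last one to the first one: a nonterminal \<open>N\<^sub>k\<close> in the rule of \<open>N\<^sub>i\<close> has
  \<open>k < i\<close> and adds \<open>W i\<close> to \<open>W k\<close>; a pair \<open>(l, j)\<close> adds \<open>W i * V ! l\<close> to the output \<open>x j\<close>.
  The output plus the weighted contribution of the symbols not yet processed is invariant.
  Since there are no useless rules, every pair of a rule occurs in some row of the matrix, so all
  memory accesses are within range.\<close>

section \<open>Running the machine\<close>

lemma run_add: "run w P inp (s + t) cfg = Option.bind (run w P inp s cfg) (run w P inp t)"
proof (induction s arbitrary: cfg)
  case (Suc s)
  then show ?case by (cases "step w P inp cfg") simp_all
qed simp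

lemma run_trans:
  "run w P inp s cfg = Some cfg' \<Longrightarrow> run w P inp t cfg' = res \<Longrightarrow> run w P inp (s + t) cfg = res"
  by (simp add: run_add)

text \<open>Keeping this append opaque lets the simplifier update a literal list of registers while
  the rest of the memory stays symbolic.\<close>

definition with_registers :: "ram_word list \<Rightarrow> ram_word list \<Rightarrow> ram_word list" where
  "with_registers rs T = rs @ T"

lemma with_registers_inject: "with_registers rs T = with_registers rs' T \<longleftrightarrow> rs = rs'"
  by (simp add: with_registers_def)

lemma fetch_with_registers:
  "fetch (with_registers rs T) a = (if a < length rs then Some (rs ! a) else fetch T (a - length rs))"
  by (auto simp: with_registers_def fetch_def nth_append)

lemma put_with_registers:
  "put (with_registers rs T) a v =
     (if a < length rs then Some (with_registers (rs[a := v]) T)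
      else map_option (with_registers rs) (put T (a - length rs) v))"
  by (auto simp: with_registers_def put_def list_update_append)

lemma run_numeral:
  "run w P inp (numeral k) cfg = Option.bind (step w P inp cfg) (run w P inp (pred_numeral k))"
  by (simp add: numeral_eq_Suc)

lemma list_update_Cons_numeral: "(x # xs)[numeral k := v] = x # xs[pred_numeral k := v]"
  by (simp add: numeral_eq_Suc)

section \<open>Concatenations of blocks of equal length\<close>

lemma length_concat_blocks:
  assumes "\<And>x. length (g x) = k"
  shows "length (concat (map g xs)) = k * length xs"
  using assms by (induction xs) simp_all

lemma nth_concat_blocks:
  assumes "\<And>x. length (g x) = k" "i < length xs" "t < k"
  shows "concat (map g xs) ! (k * i + t) = g (xs ! i) ! t"
  using assms(2)
proof (induction xs arbitrary: i)
  case (Cons x xs)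
  then show ?case
    using assms(1,3) by (cases i) (simp_all add: nth_append add.assoc)
qed simp

lemma length_encode_symbol: "length (encode_symbol s) = 3"
  by (cases s) simp_all

text \<open>The flat order makes a single counter \<open>s\<close> enough for the last loop:
  position \<open>s\<close> belongs to rule \<open>s div 2\<close>.\<close>

definition rule_symbols :: "rules \<Rightarrow> symbol list" where
  "rule_symbols R = concat (map (\<lambda>(A, B). [A, B]) R)"

lemma length_rule_symbols: "length (rule_symbols R) = 2 * length R"
  unfolding rule_symbols_def by (rule length_concat_blocks) auto

lemma rule_symbols_nth:
  assumes "i < length R"
  shows "rule_symbols R ! (2 * i) = fst (R ! i)" "rule_symbols R ! (2 * i + 1) = snd (R ! i)"
proof -
  have len: "length (case x of (A, B) \<Rightarrow> [A, B]) = 2" for x :: "symbol \<times> symbol"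
    by (cases x) simp
  show "rule_symbols R ! (2 * i) = fst (R ! i)" "rule_symbols R ! (2 * i + 1) = snd (R ! i)"
    using nth_concat_blocks[OF len assms, of 0] nth_concat_blocks[OF len assms, of 1]
    by (simp_all add: rule_symbols_def split: prod.splits)
qed

lemma concat_encode_rules:
  "concat (map (\<lambda>(A, B). encode_symbol A @ encode_symbol B) R)
     = concat (map encode_symbol (rule_symbols R))"
  by (induction R) (auto simp: rule_symbols_def)

section \<open>Column sums of expansions\<close>

inductive_cases expands_to_NtE: "expands_to R (Nt i) u"
inductive_cases expands_to_PairE: "expands_to R (Pair l j) u"

text \<open>Each nonterminal has a single rule, so a second derivation must split exactly as the
  first one does. This justifies \<open>THE\<close> in \<open>symbol_sum\<close>.\<close>

lemma expands_to_unique: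
  "expands_to R s u \<Longrightarrow> expands_to R s v \<Longrightarrow> u = v"
proof (induction arbitrary: v rule: expands_to.induct)
  case (1 l j)
  then show ?case by (auto elim: expands_to_PairE)
next
  case (2 i A B u1 u2)
  from 2(7) 2(2) obtain v1 v2 where "v = v1 @ v2" "expands_to R A v1" "expands_to R B v2"
    by (auto elim!: expands_to_NtE)
  with 2(5,6) show ?case by blast
qed

definition column_sum :: "real list \<Rightarrow> (nat \<times> nat) list \<Rightarrow> nat \<Rightarrow> real" where
  "column_sum V u j = (\<Sum>(l, j') \<leftarrow> u. if j' = j then V ! l else 0)"

text \<open>For \<open>s = Nt i\<close> this is the \<open>f i j\<close> of the overview; pairs are
  included so that both symbols of a rule are treated alike.\<close>

definition symbol_sum :: "rules \<Rightarrow> real list \<Rightarrow> symbol \<Rightarrow> nat \<Rightarrow> real" where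
  "symbol_sum R V s j = column_sum V (THE u. expands_to R s u) j"

lemma symbol_sum_eq: "expands_to R s u \<Longrightarrow> symbol_sum R V s j = column_sum V u j"
  unfolding symbol_sum_def by (metis expands_to_unique the_equality)

lemma symbol_sum_Pair: "symbol_sum R V (Pair l j') j = (if j' = j then V ! l else 0)"
  using symbol_sum_eq[OF expands_to.intros(1)] by (simp add: column_sum_def)

lemma symbol_sum_Nt:
  assumes "expands_to R (Nt i) u"
  shows "symbol_sum R V (Nt i) j = symbol_sum R V (fst (R ! i)) j + symbol_sum R V (snd (R ! i)) j"
proof -
  from assms obtain v1 v2
    where "u = v1 @ v2" "expands_to R (fst (R ! i)) v1" "expands_to R (snd (R ! i)) v2"
    by (auto elim: expands_to_NtE)
  then show ?thesis
    using assms by (simp add: symbol_sum_eq column_sum_def)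
qed

lemma sum_list_map_filter_0:
  fixes h :: "'a \<Rightarrow> 'b :: comm_monoid_add"
  assumes "\<And>x. x \<in> set xs \<Longrightarrow> \<not> Q x \<Longrightarrow> h x = 0"
  shows "(\<Sum>x \<leftarrow> filter Q xs. h x) = (\<Sum>x \<leftarrow> xs. h x)"
  using assms by (induction xs) auto

lemma value_index:
  assumes "distinct V" "x \<in> set V"
  shows "(THE l. l < length V \<and> V ! l = x) < length V" "V ! (THE l. l < length V \<and> V ! l = x) = x"
proof -
  have "\<exists>!l. l < length V \<and> V ! l = x"
    using assms by (metis distinct_Ex1)
  from theI'[OF this]
  show "(THE l. l < length V \<and> V ! l = x) < length V" "V ! (THE l. l < length V \<and> V ! l = x) = x"
    by auto
qed

text \<open>Looking an index up in \<open>V\<close> returns the matrix entry, the entries left out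
  are zero, and the row scan visits each column once, so only column \<open>j\<close>
  contributes.\<close>

lemma csrv_row_column_sum:
  assumes "distinct V" "set V = elements_mat M - {0}" "r < dim_row M" "j < dim_col M"
  shows "column_sum V (csrv_row M V r) j = M $$ (r, j)"
proof -
  let ?l = "\<lambda>j'. THE l. l < length V \<and> V ! l = M $$ (r, j')"
  have l: "V ! ?l j' = M $$ (r, j')" if "j' < dim_col M" "M $$ (r, j') \<noteq> 0" for j'
    by (rule value_index) (use assms that in auto)
  have "column_sum V (csrv_row M V r) j
      = (\<Sum>j' \<leftarrow> filter (\<lambda>j'. M $$ (r, j') \<noteq> 0) [0..<dim_col M]. if j' = j then V ! ?l j' else 0)"
    by (simp add: column_sum_def csrv_row_def comp_def)
  also have "\<dots> = (\<Sum>j' \<leftarrow> filter (\<lambda>j'. M $$ (r, j') \<noteq> 0) [0..<dim_col M].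
                    if j' = j then M $$ (r, j') else 0)"
    by (intro arg_cong[of _ _ sum_list] map_cong) (auto simp: l)
  also have "\<dots> = (\<Sum>j' \<leftarrow> [0..<dim_col M]. if j' = j then M $$ (r, j') else 0)"
    by (rule sum_list_map_filter_0) auto
  also have "\<dots> = (\<Sum>j' < dim_col M. if j' = j then M $$ (r, j') else 0)"
    by (simp add: interv_sum_list_conv_sum_set_nat atLeast0LessThan)
  also have "\<dots> = M $$ (r, j)"
    using assms(4) by simp
  finally show ?thesis .
qed

lemma csrv_row_bounds:
  assumes "distinct V" "set V = elements_mat M - {0}" "r < dim_row M"
    and "(l, j) \<in> set (csrv_row M V r)"
  shows "l < length V" "j < dim_col M"
  using assms value_index(1)[OF assms(1)] by (auto simp: csrv_row_def)

text \<open>The weight of rule \<open>i\<close> multiplies only the positions \<open>2 * i\<close>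
  and \<open>2 * i + 1\<close>; the second assumption puts both of them into the range of the
  sum.\<close>

lemma weighted_sum_update:
  fixes f :: "nat \<Rightarrow> real"
  assumes "i < length W" "2 * i + 1 < s"
  shows "(\<Sum>t<s. W[i := W ! i + x] ! (t div 2) * f t)
      = (\<Sum>t<s. W ! (t div 2) * f t) + x * (f (2 * i) + f (2 * i + 1))"
proof -
  have "(\<Sum>t<s. W[i := W ! i + x] ! (t div 2) * f t)
      = (\<Sum>t<s. W ! (t div 2) * f t + (if t div 2 = i then x * f t else 0))"
    by (rule sum.cong) (use assms in \<open>auto simp: nth_list_update algebra_simps\<close>)
  also have "\<dots> = (\<Sum>t<s. W ! (t div 2) * f t) + (\<Sum>t | t < s \<and> t div 2 = i. x * f t)"
    by (simp add: sum.distrib sum.inter_filter[symmetric])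
  also have "{t. t < s \<and> t div 2 = i} = {2 * i, 2 * i + 1}"
    using assms(2) by auto
  finally show ?thesis
    by (simp add: algebra_simps)
qed

section \<open>The program\<close>

text \<open>Registers 0 to 3, 5 and 6 hold their own number, register 4 the address of the rules in the
  input, 7 the address of the weights in the working memory, 8 and 9 the addresses of \<open>V\<close> and of the
  vector, 10 the real number 0, 11 to 13 the counters of the three loops, and 14 to 17 are scratch.
  Jump targets are absolute: the four pieces of code start at 0, 18, 23 and 35, and the
  program halts at 60.\<close>

definition setup_code :: program where
  "setup_code =
     [SetIdx 0 0, SetIdx 1 1, SetIdx 2 2, SetIdx 3 3, SetIdx 4 4, SetIdx 5 5, SetIdx 6 6,
      SetIdx 7 18, SetNum 10 0, ReadIn 12 0, ReadIn 11 2, ReadIn 9 3,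
      Arith Times 8 12 6, Arith Plus 4 4 8, Arith Times 8 11 6, Arith Plus 8 8 4, Arith Plus 9 9 8,
      Arith Plus 13 11 11]"

definition clear_code :: program where
  "clear_code =
     [JumpEq 11 0 23, Arith Minus 11 11 1, Arith Plus 14 11 7, Store 14 10, Jump 18]"

definition row_code :: program where
  "row_code =
     [JumpEq 12 0 35, Arith Minus 12 12 1, Arith Times 14 12 6, Arith Plus 14 14 5, ReadIn 14 14,
      Arith Plus 14 14 7, Load 15 14, Arith Plus 16 12 9, ReadIn 16 16, Arith Plus 15 15 16,
      Store 14 15, Jump 23]"

definition symbol_code :: program where
  "symbol_code =
     [JumpEq 13 0 60, Arith Minus 13 13 1, Arith Divide 14 13 2, Arith Plus 14 14 7, Load 14 14,
      Arith Times 15 13 3, Arith Plus 15 15 4, ReadIn 16 15, Arith Plus 15 15 1, ReadIn 17 15,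
      JumpEq 16 0 51,
      Arith Plus 17 17 7, Load 16 17, Arith Plus 16 16 14, Store 17 16, Jump 35,
      Arith Plus 17 17 8, ReadIn 17 17, Arith Times 14 14 17, Arith Plus 15 15 1, ReadIn 15 15,
      ReadOut 16 15, Arith Plus 16 16 14, WriteOut 15 16, Jump 35,
      Halt]"

definition left_product_program :: program where
  "left_product_program = setup_code @ clear_code @ row_code @ symbol_code"

lemma length_codes:
  "length setup_code = 18" "length clear_code = 5" "length row_code = 12" "length symbol_code = 26"
  by (simp_all add: setup_code_def clear_code_def row_code_def symbol_code_def)

lemma length_program: "length left_product_program = 61"
  by (simp add: left_product_program_def length_codes)

lemma program_nth:
  "a < 18 \<Longrightarrow> left_product_program ! a = setup_code ! a"
  "18 \<le> a \<Longrightarrow> a < 23 \<Longrightarrow> left_product_program ! a = clear_code ! (a - 18)"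
  "23 \<le> a \<Longrightarrow> a < 35 \<Longrightarrow> left_product_program ! a = row_code ! (a - 23)"
  "35 \<le> a \<Longrightarrow> a < 61 \<Longrightarrow> left_product_program ! a = symbol_code ! (a - 35)"
  by (auto simp: left_product_program_def nth_append length_codes)

text \<open>Rewriting with these rules executes the program symbolically, one instruction at a time,
  for a numeral number of steps.\<close>

lemmas machine_simps =
  run_numeral with_registers_inject step_def length_program fetch_with_registers
  put_with_registers list_update_Cons_numeral
  fetch_idx_def make_idx_def

section \<open>Addresses of the data in the input\<close>

locale left_product =
  fixes n m :: nat and M :: "real mat" and C :: "symbol list" and \<iota> :: "nat \<Rightarrow> nat" and R :: rules
    and V :: "real list" and y :: "real vec" and w :: nat
  assumes n_pos: "0 < n"
    and M_carrier: "M \<in> carrier_mat n m"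
    and y_carrier: "y \<in> carrier_vec n"
    and V_distinct: "distinct V"
    and set_V: "set V = elements_mat M - {0}"
    and sl: "straight_line R"
    and C_eq: "C = concat (map (\<lambda>r. [Nt (\<iota> r), EndRow r]) [0..<n])"
    and row_less: "\<And>r. r < n \<Longrightarrow> \<iota> r < length R"
    and row_expands: "\<And>r. r < n \<Longrightarrow> expands_to R (Nt (\<iota> r)) (csrv_row M V r)"
    and useful: "no_useless_rules C R"
    and word_length: "100 * (length (encode_input n m C R V y) + m) \<le> 2 ^ w"
begin

abbreviation "q \<equiv> length R"
abbreviation "inp \<equiv> encode_input n m C R V y"
abbreviation "baseR \<equiv> 4 + 6 * n"
abbreviation "baseV \<equiv> baseR + 6 * q"
abbreviation "baseY \<equiv> baseV + length V"

lemma length_C: "length C = 2 * n"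
  unfolding C_eq by (subst length_concat_blocks[where k = 2]) auto

lemma C_nth: "r < n \<Longrightarrow> C ! (2 * r) = Nt (\<iota> r)"
  unfolding C_eq using nth_concat_blocks[where g = "\<lambda>r. [Nt (\<iota> r), EndRow r]" and k = 2 and t = 0
      and i = r and xs = "[0..<n]"] by simp

lemma set_C: "set C = (\<lambda>r. Nt (\<iota> r)) ` {..<n} \<union> EndRow ` {..<n}"
  unfolding C_eq by auto

lemma inp_eq:
  "inp = [Idx n, Idx m, Idx q, Idx (length V)] @ concat (map encode_symbol C)
     @ concat (map encode_symbol (rule_symbols R)) @ map Num V @ map Num (list_of_vec y)"
  by (simp add: encode_input_def concat_encode_rules)

lemma length_encode_symbols: "length (concat (map encode_symbol ss)) = 3 * length ss"
  by (rule length_concat_blocks[OF length_encode_symbol])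

lemma length_inp: "length inp = baseY + n"
  using y_carrier by (simp add: inp_eq length_encode_symbols length_C length_rule_symbols)

lemma inp_header: "inp ! 0 = Idx n" "inp ! 2 = Idx q" "inp ! 3 = Idx (length V)"
  by (simp_all add: encode_input_def)

text \<open>The header takes 4 words and each row of \<open>C\<close> takes 6, so the second word of
  the nonterminal of row \<open>r\<close> is at \<open>4 + 6 * r + 1\<close>.\<close>

lemma inp_row: assumes "r < n" shows "inp ! (r * 6 + 5) = Idx (\<iota> r)"
proof -
  have "inp ! (r * 6 + 5) = concat (map encode_symbol C) ! (3 * (2 * r) + 1)"
    using assms
    by (simp add: inp_eq nth_append nth_Cons' length_encode_symbols length_C algebra_simps)
  also have "\<dots> = Idx (\<iota> r)"
    using assms by (subst nth_concat_blocks[OF length_encode_symbol])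
      (simp_all add: length_C C_nth)
  finally show ?thesis .
qed

lemma inp_symbol:
  assumes "s < 2 * q" "t < 3"
  shows "inp ! (baseR + (3 * s + t)) = encode_symbol (rule_symbols R ! s) ! t"
proof -
  have "inp ! (baseR + (3 * s + t)) = concat (map encode_symbol (rule_symbols R)) ! (3 * s + t)"
    using assms
    by (simp add: inp_eq nth_append length_encode_symbols length_C length_rule_symbols)
  also have "\<dots> = encode_symbol (rule_symbols R ! s) ! t"
    by (rule nth_concat_blocks[OF length_encode_symbol])
      (use assms in \<open>simp_all add: length_rule_symbols\<close>)
  finally show ?thesis .
qed

lemma inp_V: "l < length V \<Longrightarrow> inp ! (l + baseV) = Num (V ! l)"
  by (simp add: inp_eq nth_append length_encode_symbols length_C length_rule_symbols)

lemma inp_y: "r < n \<Longrightarrow> inp ! (r + baseY) = Num (y $ r)"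
  using y_carrier
  by (simp add: inp_eq nth_append length_encode_symbols length_C length_rule_symbols
      list_of_vec_index)

text \<open>Discharges the overflow checks: the indices that the program computes are constants or
  linear in the sizes with small coefficients.\<close>

lemma index_bound: "a < 100 * (baseY + n) \<Longrightarrow> a < 2 ^ w"
  using word_length length_inp by simp

section \<open>Symbolic execution of one pass of each loop\<close>

abbreviation registers where
  "registers i r s a b c d \<equiv>
     [Idx 0, Idx 1, Idx 2, Idx 3, Idx baseR, Idx 5, Idx 6, Idx 18, Idx baseV, Idx baseY, Num 0,
      Idx i, Idx r, Idx s, a, b, c, d]"

text \<open>A set, because the contents of the four scratch registers are to be forgotten between
  passes.\<close>

definition configs :: "nat \<Rightarrow> nat \<Rightarrow> nat \<Rightarrow> nat \<Rightarrow> ram_word list \<Rightarrow> ram_word list \<Rightarrow> config set" where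
  "configs pc i r s T out = {(pc, with_registers (registers i r s a b c d) T, out) | a b c d. True}"

definition reaches :: "nat \<Rightarrow> config set \<Rightarrow> config set \<Rightarrow> bool" where
  "reaches t S S' \<longleftrightarrow> (\<forall>cfg \<in> S. \<exists>cfg' \<in> S'. run w left_product_program inp t cfg = Some cfg')"

lemma reaches_refl: "reaches 0 S S"
  by (simp add: reaches_def)

lemma reaches_trans [trans]: "reaches s S S' \<Longrightarrow> reaches t S' S'' \<Longrightarrow> reaches (s + t) S S''"
  unfolding reaches_def by (metis run_trans)

text \<open>There is a row, and its nonterminal has a rule. This lets linear bounds absorb the
  constant costs.\<close>

lemma q_pos: "0 < q"
  using row_less[of 0] n_pos by (cases R) auto

lemma run_setup:
  assumes "18 \<le> length mem"
  shows "reaches 18 {(0, mem, out)} (configs 18 q n (2 * q) (drop 18 mem) out)"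
proof -
  \<comment> \<open>Writes the arbitrary contents of the 18 register cells as an explicit list that
    the setup code can overwrite symbolically.\<close>
  have mem: "mem = with_registers (map ((!) mem) [0..<18]) (drop 18 mem)"
    using assms by (auto simp: with_registers_def list_eq_iff_nth_eq nth_append)
  have hd: "fetch inp 0 = Some (Idx n)" "fetch inp 2 = Some (Idx q)"
     "fetch inp 3 = Some (Idx (length V))"
    using inp_header by (simp_all add: fetch_def length_inp)
  show ?thesis
    unfolding reaches_def configs_def
    by (subst mem) (simp add: machine_simps program_nth setup_code_def hd index_bound upt_rec
        ac_simps mult_2_right)
qed

lemma run_clear_step:
  assumes "i < length T" "Suc i \<le> q"
  shows "reaches 5 (configs 18 (Suc i) n (2 * q) T out)
    (configs 18 i n (2 * q) (T[i := Num 0]) out)"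
proof -
  have "put T i (Num 0) = Some (T[i := Num 0])"
    using assms by (simp add: put_def)
  then show ?thesis
    using assms by (auto simp: reaches_def configs_def machine_simps program_nth clear_code_def
        index_bound)
qed

lemma run_row_step:
  assumes "r < n" "\<iota> r < length T" "T ! \<iota> r = Num x"
  shows "reaches 12 (configs 23 0 (Suc r) (2 * q) T out)
    (configs 23 0 r (2 * q) (T[\<iota> r := Num (x + y $ r)]) out)"
proof -
  have "put T (\<iota> r) v = Some (T[\<iota> r := v])" "fetch T (\<iota> r) = Some (Num x)" for v
    using assms by (simp_all add: put_def fetch_def)
  moreover have "fetch inp (r * 6 + 5) = Some (Idx (\<iota> r))" "fetch inp (r + baseY) = Some (Num (y $ r))"
    using inp_row[of r] inp_y[of r] assms by (simp_all add: fetch_def length_inp)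
  ultimately show ?thesis
    using assms row_less[OF assms(1)]
    by (auto simp: reaches_def configs_def machine_simps program_nth row_code_def
        index_bound)
qed

lemma fetch_inp_symbol:
  assumes "s < 2 * q" "t < 3"
  shows "fetch inp (s * 3 + baseR + t) = Some (encode_symbol (rule_symbols R ! s) ! t)"
  using inp_symbol[OF assms] assms by (simp add: fetch_def length_inp ac_simps)

text \<open>Eleven instructions fetch the weight and the symbol; kind 1 falls through the branch,
  and five more update the weight of \<open>Nt i\<close>.\<close>

lemma run_symbol_step_Nt:
  assumes "s < 2 * q" "rule_symbols R ! s = Nt i" "i < q" "q \<le> length T"
    and "T ! (s div 2) = Num x" "T ! i = Num z"
  shows "reaches 16 (configs 35 0 0 (Suc s) T out)
    (configs 35 0 0 s (T[i := Num (z + x)]) out)"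
proof -
  have "put T i v = Some (T[i := v])" "fetch T i = Some (Num z)"
     "fetch T (s div 2) = Some (Num x)" for v
    using assms by (auto simp: put_def fetch_def)
  moreover have "fetch inp (s * 3 + baseR) = Some (Idx 1)" "fetch inp (Suc (s * 3 + baseR)) = Some (Idx i)"
    using fetch_inp_symbol[of s 0] fetch_inp_symbol[of s 1] assms by simp_all
  ultimately show ?thesis
    using assms
    by (auto simp: reaches_def configs_def machine_simps program_nth symbol_code_def
        index_bound)
qed

text \<open>Kind 0 takes the branch, and nine instructions after the common eleven update the
  output.\<close>

lemma run_symbol_step_Pair:
  assumes "s < 2 * q" "rule_symbols R ! s = Pair l j" "l < length V" "j < length out"
    "length out = m" "q \<le> length T"
    and "T ! (s div 2) = Num x" "out ! j = Num z"
  shows "reaches 20 (configs 35 0 0 (Suc s) T out)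
    (configs 35 0 0 s T (out[j := Num (z + x * V ! l)]))"
proof -
  have "put out j v = Some (out[j := v])" "fetch out j = Some (Num z)"
     "fetch T (s div 2) = Some (Num x)" for v
    using assms by (auto simp: put_def fetch_def)
  moreover have "fetch inp (s * 3 + baseR) = Some (Idx 0)" "fetch inp (Suc (s * 3 + baseR)) = Some (Idx l)"
     "fetch inp (Suc (Suc (s * 3 + baseR))) = Some (Idx j)"
    using fetch_inp_symbol[of s 0] fetch_inp_symbol[of s 1] fetch_inp_symbol[of s 2] assms
    by (simp_all add: numeral_2_eq_2)
  moreover have "fetch inp (l + baseV) = Some (Num (V ! l))"
    using inp_V assms by (simp add: fetch_def length_inp)
  ultimately show ?thesis
    using assms
    by (auto simp: reaches_def configs_def machine_simps program_nth symbol_code_def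
        index_bound)
qed

section \<open>Symbols of useful rules are in range\<close>

text \<open>Descending induction on \<open>i\<close>: a useful \<open>Nt i\<close> generates a row
  itself or occurs in the rule of some larger \<open>i'\<close>, whose expansion contains that of
  \<open>Nt i\<close>.\<close>

lemma rule_expands_within_row:
  "i < q \<Longrightarrow> \<exists>r < n. \<exists>u. expands_to R (Nt i) u \<and> set u \<subseteq> set (csrv_row M V r)"
proof (induction "q - i" arbitrary: i rule: less_induct)
  case less
  consider "Nt i \<in> set C" | A B where "(A, B) \<in> set R" "A = Nt i \<or> B = Nt i"
    using useful less.prems by (auto simp: no_useless_rules_def)
  then show ?case
  proof cases
    case 1
    then show ?thesis
      using row_expands by (auto simp: set_C)
  next
    case 2
    then obtain i' where i': "i' < q" "R ! i' = (A, B)"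
      by (auto simp: in_set_conv_nth)
    then have "i < i'"
      using 2 sl by (auto simp: straight_line_def)
    then obtain r u where "r < n" "expands_to R (Nt i') u" "set u \<subseteq> set (csrv_row M V r)"
      using less.hyps[of i'] i' by (meson diff_less_mono2 less_trans)
    moreover from this i'(2) obtain v1 v2
      where v: "u = v1 @ v2" "expands_to R A v1" "expands_to R B v2"
      by (auto elim: expands_to_NtE)
    ultimately have "set v1 \<subseteq> set (csrv_row M V r)" "set v2 \<subseteq> set (csrv_row M V r)"
      by simp_all
    with v 2(2) \<open>r < n\<close> show ?thesis by blast
  qed
qed

text \<open>A pair in a rule belongs to the expansion of that rule, hence to some row, and the pairs
  of a row are in range. For nonterminals the bound is straight-line order.\<close>

lemma rule_symbols_nth_cases:
  assumes "s < 2 * q"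
  obtains (Pair) l j where "rule_symbols R ! s = Pair l j" "l < length V" "j < m"
    | (Nt) i where "rule_symbols R ! s = Nt i" "i < s div 2"
proof -
  let ?i = "s div 2"
  have i: "?i < q" using assms by simp
  have "s = 2 * ?i \<or> s = 2 * ?i + 1" by presburger
  then have sym: "rule_symbols R ! s = fst (R ! ?i) \<or> rule_symbols R ! s = snd (R ! ?i)"
    using rule_symbols_nth[OF i] by metis
  then have ok: "rule_symbol_ok ?i (rule_symbols R ! s)"
    using sl i by (auto simp: straight_line_def)
  obtain r u where r: "r < n" "expands_to R (Nt ?i) u" "set u \<subseteq> set (csrv_row M V r)"
    using rule_expands_within_row[OF i] by auto
  show thesis
  proof (cases "rule_symbols R ! s")
    case (Pair l j)
    obtain v1 v2
      where "u = v1 @ v2" "expands_to R (fst (R ! ?i)) v1" "expands_to R (snd (R ! ?i)) v2"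
      using r(2) by (auto elim: expands_to_NtE)
    with sym Pair have "(l, j) \<in> set u"
      by (metis Un_iff expands_to_PairE list.set_intros(1) set_append)
    then have "(l, j) \<in> set (csrv_row M V r)"
      using r(3) by auto
    then show thesis
      using that(1)[OF Pair] csrv_row_bounds[OF V_distinct set_V] r(1) M_carrier by auto
  qed (use ok that in auto)
qed

text \<open>Not an entry of the weight list \<open>W\<close> but the factor that such an entry
  multiplies: the column sum of the symbol at position \<open>s\<close>.\<close>

abbreviation "weight s j \<equiv> symbol_sum R V (rule_symbols R ! s) j"

lemma symbol_sum_Nt_weight:
  assumes "i < q"
  shows "symbol_sum R V (Nt i) j = weight (2 * i) j + weight (2 * i + 1) j"
proof -
  obtain u where "expands_to R (Nt i) u"
    using rule_expands_within_row[OF assms] by blast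
  from symbol_sum_Nt[OF this] show ?thesis
    using rule_symbols_nth[OF assms] by simp
qed

section \<open>Loop invariants\<close>

lemma run_clear:
  assumes "i \<le> q" "i \<le> length T"
  shows "reaches (5 * i) (configs 18 i n (2 * q) T out)
    (configs 18 0 n (2 * q) (replicate i (Num 0) @ drop i T) out)"
  using assms
proof (induction i arbitrary: T)
  case 0
  then show ?case by (simp add: reaches_refl)
next
  case (Suc i)
  \<comment> \<open>The counter runs downwards, so cell \<open>i\<close> is cleared first and then
    heads the part that the remaining passes leave alone.\<close>
  have "replicate i (Num 0) @ drop i (T[i := Num 0]) = replicate (Suc i) (Num 0) @ drop (Suc i) T"
    using Suc.prems by (simp add: drop_update_swap Cons_nth_drop_Suc[symmetric] replicate_app_Cons_same)
  then show ?case
    using reaches_trans[OF run_clear_step Suc.IH[of "T[i := Num 0]"]] Suc.prems by simp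
qed

text \<open>Adding \<open>y $ r\<close> to the weight of \<open>\<iota> r\<close> raises the
  weighted sum by \<open>y $ r\<close> times the column sum of row \<open>r\<close>, which is
  \<open>M $$ (r, j)\<close>. Rows sharing a nonterminal accumulate.\<close>

lemma run_rows:
  assumes "r \<le> n" "length W = q"
  shows "\<exists>W'. length W' = q \<and>
      reaches (12 * r) (configs 23 0 r (2 * q) (map Num W @ T) out)
        (configs 23 0 0 (2 * q) (map Num W' @ T) out) \<and>
      (\<forall>j < m. (\<Sum>s<2*q. W' ! (s div 2) * weight s j)
         = (\<Sum>s<2*q. W ! (s div 2) * weight s j) + (\<Sum>r'<r. y $ r' * M $$ (r', j)))"
  using assms
proof (induction r arbitrary: W)
  case 0
  then show ?case
    by (intro exI[of _ W]) (simp add: reaches_refl)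
next
  case (Suc r)
  let ?W = "W[\<iota> r := W ! \<iota> r + y $ r]"
  have \<iota>: "\<iota> r < q" and r: "r < n" using row_less Suc.prems by auto
  have "(map Num W @ T)[\<iota> r := Num (W ! \<iota> r + y $ r)] = map Num ?W @ T"
    using \<iota> Suc.prems by (simp add: list_update_append map_update)
  then have step: "reaches 12 (configs 23 0 (Suc r) (2 * q) (map Num W @ T) out)
      (configs 23 0 r (2 * q) (map Num ?W @ T) out)"
    using run_row_step[OF r, of "map Num W @ T" "W ! \<iota> r"] \<iota> Suc.prems(2)
    by (simp add: nth_append)
  obtain W' where W': "length W' = q"
      "reaches (12 * r) (configs 23 0 r (2 * q) (map Num ?W @ T) out)
        (configs 23 0 0 (2 * q) (map Num W' @ T) out)"
      "\<And>j. j < m \<Longrightarrow> (\<Sum>s<2*q. W' ! (s div 2) * weight s j)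
         = (\<Sum>s<2*q. ?W ! (s div 2) * weight s j) + (\<Sum>r'<r. y $ r' * M $$ (r', j))"
    using Suc.IH[of ?W] Suc.prems by auto
  have "(\<Sum>s<2*q. W' ! (s div 2) * weight s j)
      = (\<Sum>s<2*q. W ! (s div 2) * weight s j) + (\<Sum>r'<Suc r. y $ r' * M $$ (r', j))"
    if j: "j < m" for j
  proof -
    have "symbol_sum R V (Nt (\<iota> r)) j = M $$ (r, j)"
      using symbol_sum_eq[OF row_expands[OF r]] M_carrier r j
        csrv_row_column_sum[OF V_distinct set_V, of r j] by simp
    then show ?thesis
      using symbol_sum_Nt_weight[OF \<iota>, of j] W'(3)[OF j]
        weighted_sum_update[of "\<iota> r" W "2 * q"] \<iota> Suc.prems(2) by simp
  qed
  then show ?case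
    using reaches_trans[OF step W'(2)] W'(1) by auto
qed

text \<open>Each pass preserves the output plus the weighted sum over the positions still to be
  processed; the bound 20 is the length of the longer branch.\<close>

lemma run_symbols:
  assumes "s \<le> 2 * q" "length W = q" "length X = m"
  shows "\<exists>t W' X'. t \<le> 20 * s \<and> length X' = m \<and>
      reaches t (configs 35 0 0 s (map Num W @ T) (map Num X))
        (configs 35 0 0 0 (map Num W' @ T) (map Num X')) \<and>
      (\<forall>j < m. X' ! j = X ! j + (\<Sum>t<s. W ! (t div 2) * weight t j))"
  using assms
proof (induction s arbitrary: W X)
  case 0
  then show ?case
    by (intro exI[of _ 0] exI[of _ W] exI[of _ X]) (simp add: reaches_refl)
next
  case (Suc s)
  have s: "s < 2 * q" using Suc.prems by simp
  let ?x = "W ! (s div 2)"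
  have x: "(map Num W @ T) ! (s div 2) = Num ?x"
    using s Suc.prems(2) by (simp add: nth_append less_mult_imp_div_less mult.commute)
  obtain t W1 X1 where W1: "length W1 = q" "length X1 = m" "t \<le> 20"
    and step: "reaches t (configs 35 0 0 (Suc s) (map Num W @ T) (map Num X))
      (configs 35 0 0 s (map Num W1 @ T) (map Num X1))"
    and sums: "\<And>j. j < m \<Longrightarrow> X1 ! j + (\<Sum>t<s. W1 ! (t div 2) * weight t j)
      = X ! j + (\<Sum>t<Suc s. W ! (t div 2) * weight t j)"
    using s
  proof (cases rule: rule_symbols_nth_cases)
    case (Pair l j)
    let ?X = "X[j := X ! j + ?x * V ! l]"
    have "reaches 20 (configs 35 0 0 (Suc s) (map Num W @ T) (map Num X))
        (configs 35 0 0 s (map Num W @ T) (map Num ?X))"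
      using run_symbol_step_Pair[OF s Pair(1,2) _ _ _ x, of "map Num X" "X ! j"] Pair(3) Suc.prems
      by (simp add: map_update)
    \<comment> \<open>The summand at position \<open>s\<close> moves from the sum into the
      output.\<close>
    moreover have "?X ! j' + (\<Sum>t<s. W ! (t div 2) * weight t j')
      = X ! j' + (\<Sum>t<Suc s. W ! (t div 2) * weight t j')" if "j' < m" for j'
      using Pair(1,3) Suc.prems(3) that by (simp add: symbol_sum_Pair nth_list_update)
    ultimately show thesis
      using that[of W ?X 20] Suc.prems by simp
  next
    case (Nt i)
    let ?W = "W[i := W ! i + ?x]"
    \<comment> \<open>Since \<open>i < s div 2\<close>, both positions of rule \<open>i\<close> are
      still to be processed, so the increased weight takes full effect.\<close>
    have i: "i < q" "2 * i + 1 < s" using Nt s by auto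
    then have "(map Num W @ T)[i := Num (W ! i + ?x)] = map Num ?W @ T"
      using Suc.prems by (simp add: list_update_append map_update)
    then have "reaches 16 (configs 35 0 0 (Suc s) (map Num W @ T) (map Num X))
        (configs 35 0 0 s (map Num ?W @ T) (map Num X))"
      using run_symbol_step_Nt[OF s Nt(1) i(1) _ x, of "W ! i"] i Suc.prems
      by (simp add: nth_append)
    \<comment> \<open>The lost summand at \<open>s\<close> is \<open>?x\<close> times the column sum
      of \<open>Nt i\<close>, which is what the increased weight adds at the two positions of rule
      \<open>i\<close>.\<close>
    moreover have "X ! j + (\<Sum>t<s. ?W ! (t div 2) * weight t j)
      = X ! j + (\<Sum>t<Suc s. W ! (t div 2) * weight t j)" for j
      using weighted_sum_update[of i W s] i Suc.prems(2) Nt(1) symbol_sum_Nt_weight[OF i(1)] by simp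
    ultimately show thesis
      using that[of ?W X 16] Suc.prems by simp
  qed
  obtain t' W' X' where "t' \<le> 20 * s" "length X' = m"
      "reaches t' (configs 35 0 0 s (map Num W1 @ T) (map Num X1))
        (configs 35 0 0 0 (map Num W' @ T) (map Num X'))"
      "\<And>j. j < m \<Longrightarrow> X' ! j = X1 ! j + (\<Sum>t<s. W1 ! (t div 2) * weight t j)"
    using Suc.IH[of W1 X1] Suc.prems W1 by auto
  then have "t + t' \<le> 20 * Suc s" "length X' = m"
      "reaches (t + t') (configs 35 0 0 (Suc s) (map Num W @ T) (map Num X))
        (configs 35 0 0 0 (map Num W' @ T) (map Num X'))"
      "\<forall>j < m. X' ! j = X ! j + (\<Sum>t<Suc s. W ! (t div 2) * weight t j)"
    using reaches_trans[OF step] W1 sums by simp_all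
  then show ?case by blast
qed

section \<open>Composition of the phases and total cost\<close>

lemma run_exits:
  "reaches 1 (configs 18 0 r s T out) (configs 23 0 r s T out)"
  "reaches 1 (configs 23 i 0 s T out) (configs 35 i 0 s T out)"
  "reaches 1 (configs 35 i r 0 T out) (configs 60 i r 0 T out)"
  by (auto simp: reaches_def configs_def machine_simps program_nth clear_code_def row_code_def
      symbol_code_def)

theorem left_product_program_correct:
  assumes "length mem = 100 * q"
  shows "computes_within w left_product_program inp mem (replicate m (Num 0))
    (100 * (length C + q)) (map Num (list_of_vec (vec_mult_mat y M)))"
proof -
  let ?W = "replicate q (0 :: real)" and ?X = "replicate m (0 :: real)"
  let ?T = "drop q (drop 18 mem)"
  \<comment> \<open>The registers and the \<open>q\<close> weights fit because
    \<open>18 + q \<le> 100 * q\<close> when \<open>q\<close> is positive.\<close>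
  have mem: "18 \<le> length mem" "q \<le> length (drop 18 mem)"
    using assms q_pos by (linarith, simp)
  have clear: "reaches (5 * q) (configs 18 q n (2 * q) (drop 18 mem) (map Num ?X))
      (configs 18 0 n (2 * q) (map Num ?W @ ?T) (map Num ?X))"
    using run_clear[OF order_refl mem(2)] by simp
  obtain W' where W': "length W' = q"
    "reaches (12 * n) (configs 23 0 n (2 * q) (map Num ?W @ ?T) (map Num ?X))
      (configs 23 0 0 (2 * q) (map Num W' @ ?T) (map Num ?X))"
    "\<forall>j < m. (\<Sum>s<2*q. W' ! (s div 2) * weight s j)
         = (\<Sum>s<2*q. ?W ! (s div 2) * weight s j) + (\<Sum>r'<n. y $ r' * M $$ (r', j))"
    using run_rows[OF order_refl length_replicate, where T = ?T and out = "map Num ?X"] by blast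
  obtain t W'' X where X: "t \<le> 20 * (2 * q)" "length X = m"
    "reaches t (configs 35 0 0 (2 * q) (map Num W' @ ?T) (map Num ?X))
      (configs 35 0 0 0 (map Num W'' @ ?T) (map Num X))"
    "\<forall>j < m. X ! j = ?X ! j + (\<Sum>s<2*q. W' ! (s div 2) * weight s j)"
    using run_symbols[OF order_refl W'(1) length_replicate, where T = ?T] by blast
  note run_setup[OF mem(1)]
  also note clear also note run_exits(1) also note W'(2) also note run_exits(2)
  also note X(3) also note run_exits(3)
  finally obtain mem' where run: "run w left_product_program inp (18 + 5 * q + 1 + 12 * n + 1 + t + 1)
      (0, mem, map Num ?X) = Some (60, mem', map Num X)"
    by (auto simp: reaches_def configs_def simp del: map_replicate)
  \<comment> \<open>Weights and output both start as zero, so only the row contributions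
    remain.\<close>
  have "X ! j = (\<Sum>r<n. y $ r * M $$ (r, j))" if "j < m" for j
    using that X(4) W'(3) by simp
  then have X_eq: "X = list_of_vec (vec_mult_mat y M)"
    using M_carrier X(2)
    by (simp add: list_eq_iff_nth_eq list_of_vec_index vec_mult_mat_def scalar_prod_def
        atLeast0LessThan)
  have "left_product_program ! 60 = Halt"
    by (simp add: program_nth symbol_code_def)
  then have "halted left_product_program (60, mem', map Num X)"
    by (simp add: halted_def length_program)
  \<comment> \<open>With \<open>t \<le> 40 * q\<close> the total is at most
    \<open>21 + 45 * q + 12 * n\<close>; \<open>q_pos\<close> absorbs the 21, and
    \<open>length C\<close> is \<open>2 * n\<close>.\<close>
  moreover have "18 + 5 * q + 1 + 12 * n + 1 + t + 1 \<le> 100 * (length C + q)"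
    using X(1) q_pos n_pos by (simp add: length_C)
  ultimately show ?thesis
    using run unfolding computes_within_def X_eq[symmetric] map_replicate by blast
qed

end

theorem theorem3p10:
  shows "\<exists>(P :: program) (c :: nat).
     \<forall>(n :: nat) (m :: nat) (M :: real mat) (C :: symbol list) (R :: rules) (V :: real list)
       (y :: real vec) (w :: nat) (mem :: ram_word list).
       0 < n \<longrightarrow> M \<in> carrier_mat n m \<longrightarrow>
       grammar_representation M C R V \<longrightarrow> no_useless_rules C R \<longrightarrow>
       y \<in> carrier_vec n \<longrightarrow>
       c * (length (encode_input n m C R V y) + m) \<le> 2 ^ w \<longrightarrow>
       length mem = c * length R \<longrightarrow>
       computes_within w P (encode_input n m C R V y) mem (replicate m (Num 0))
         (c * (length C + length R))
         (map Num (list_of_vec (vec_mult_mat y M)))"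
proof (intro exI allI impI)
  fix n m :: nat and M C R V and y :: "real vec" and w and mem :: "ram_word list"
  assume "0 < n" and M: "M \<in> carrier_mat n m" and g: "grammar_representation M C R V"
    and "no_useless_rules C R" "y \<in> carrier_vec n"
    and "100 * (length (encode_input n m C R V y) + m) \<le> 2 ^ w"
    and mem: "length mem = 100 * length R"
  moreover from g M obtain \<iota> where
    "C = concat (map (\<lambda>r. [Nt (\<iota> r), EndRow r]) [0..<n])"
    "\<And>r. r < n \<Longrightarrow> \<iota> r < length R \<and> expands_to R (Nt (\<iota> r)) (csrv_row M V r)"
    by (auto simp: grammar_representation_def)
  ultimately interpret left_product n m M C \<iota> R V y w
    by unfold_locales (auto simp: grammar_representation_def)
  \<comment> \<open>Fixes both witnesses: one constant, 100, serves word length, working memory and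
    time.\<close>
  show "computes_within w left_product_program (encode_input n m C R V y) mem
      (replicate m (Num 0)) (100 * (length C + length R))
      (map Num (list_of_vec (vec_mult_mat y M)))"
    by (rule left_product_program_correct[OF mem])
qed

end
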